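(* Let $(K,v_0)$ be a valued field and $x$ transcendental over $K$. If $(K,v_0)$ lies dense in its algebraic closure, then $v_0K$ is divisible, $Kv_0$ is algebraically closed, and every extension $(K(x)|K,v)$ of $v_0$ to $K(x)$ is almost pure (in $x$).
   Context: Valuations are Krull valuations written additively; $vK$ is the value group, $Kv$ the residue field, $tv$ the residue of $t$. $(K,v_0)$ lies dense in its algebraic closure $\tilde K$ if for some (equivalently, every) extension $v$ of $v_0$ to $\tilde K$, for all $a\in\tilde K$ and $\alpha\in v\tilde K$ there is $c\in K$ with $v(a-c)>\alpha$. For an extension $(K(x)|K,v)$, let $\mathrm{appr}_v(x,K)_\gamma=\{c\in K\mid v(x-c)\ge\gamma\}$ for $\gamma\in vK$, and let $S$ be the set of all $\gamma\in vK$ with $\mathrm{appr}_v(x,K)_\gamma\neq\emptyset$ (the support of the approximation type $\mathrm{appr}_v(x,K)$). The approximation type $\mathrm{appr}_v(x,K)$ is immediate if $S\ne\emptyset$ and the intersection of all nonempty sets of the form $\{c\in K\mid v(x-c)\ge\gamma\}$ or $\{c\in K\mid v(x-c)>\gamma\}$ ($\gamma\in vK$) is empty. If it is immediate, it is called transcendental if for every polynomial $f\in K[X]$ there is $\delta\in S$ such that $vf(c)$ is constant for $c\in\mathrm{appr}_v(x,K)_\delta$, and algebraic otherwise. It is an algebraic completion type if it is algebraic immediate and $S=vK$. An element $t\in K(x)$ is value-transcendental if $vt$ is not a torsion element modulo $v_0K$; residue-transcendental if $vt=0$ and $tv$ is transcendental over $Kv_0$; valuation-transcendental if it is one of the two.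 The extension $(K(x)|K,v)$ is pure (in $x$) if either $d(x-b)$ is valuation-transcendental for some $b,d\in K$, or $\mathrm{appr}_v(x,K)$ is a transcendental immediate approximation type. It is almost pure (in $x$) if it is pure or $\mathrm{appr}_v(x,K)$ is an algebraic completion type. *)

theory Defs
  imports
    "HOL-Library.Extended"
    "HOL-Algebra.Algebraic_Closure_Type"
    "HOL-Algebra.Generated_Fields"
begin

section \<open>Valued fields\<close>

text \<open>
  A Krull valuation, written additively, takes its values in \<open>\<Gamma> \<union> {\<infinity>}\<close> for a linearly ordered
  abelian group \<open>\<Gamma>\<close>. The type \<^typ>\<open>'g extended\<close> also has a bottom element \<^term>\<open>Minf\<close>, which
  the axioms prevent from being a value. The valuation need not be onto: \<open>\<Gamma>\<close> is only an ambient
  group, and the value group is the set of finite values. The trivial valuation is allowed.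
\<close>

locale krull_valuation =
  fixes v :: "'k :: field \<Rightarrow> 'g :: linordered_ab_group_add extended"
  assumes val_zero: "v 0 = \<infinity>"
    and val_nonzero: "a \<noteq> 0 \<Longrightarrow> \<exists>\<gamma>. v a = Fin \<gamma>"
    and val_mult: "v (a * b) = v a + v b"
    and val_add: "min (v a) (v b) \<le> v (a + b)"

definition value_group :: "('k :: field \<Rightarrow> 'g :: linordered_ab_group_add extended) \<Rightarrow> 'g set" where
  "value_group v = {\<gamma>. Fin \<gamma> \<in> range v}"

definition divisible :: "'g :: ab_group_add set \<Rightarrow> bool" where
  "divisible G \<longleftrightarrow> (\<forall>\<gamma>\<in>G. \<forall>n::nat. n > 0 \<longrightarrow> (\<exists>\<delta>\<in>G. (\<Sum>i<n. \<delta>) = \<gamma>))"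

definition valuation_ring :: "('k :: field \<Rightarrow> 'g :: linordered_ab_group_add extended) \<Rightarrow> 'k ring" where
  "valuation_ring v = ring_of_type_algebra \<lparr> carrier := {a. 0 \<le> v a} \<rparr>"

definition maximal_ideal :: "('k :: field \<Rightarrow> 'g :: linordered_ab_group_add extended) \<Rightarrow> 'k set" where
  "maximal_ideal v = {a. 0 < v a}"

definition residue_field :: "('k :: field \<Rightarrow> 'g :: linordered_ab_group_add extended) \<Rightarrow> 'k set ring" where
  "residue_field v = valuation_ring v Quot maximal_ideal v"

text \<open>The residue of \<open>t\<close>; meaningful for \<open>t\<close> in the valuation ring only.\<close>

definition residue :: "('k :: field \<Rightarrow> 'g :: linordered_ab_group_add extended) \<Rightarrow> 'k \<Rightarrow> 'k set" where
  "residue v t = maximal_ideal v +>\<^bsub>valuation_ring v\<^esub> t"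


section \<open>Extensions\<close>

text \<open>A field extension is given by an embedding \<open>e\<close> of the type \<open>'k\<close> into the type \<open>'l\<close>.\<close>

definition field_embedding :: "('k :: field \<Rightarrow> 'l :: field) \<Rightarrow> bool" where
  "field_embedding e \<longleftrightarrow> e \<in> ring_hom ring_of_type_algebra ring_of_type_algebra"

text \<open>The type \<open>'l\<close> is the field \<open>K(x)\<close>, and \<open>x\<close> is transcendental over \<open>K\<close>.\<close>

definition simple_transcendental_extension :: "('k :: field \<Rightarrow> 'l :: field) \<Rightarrow> 'l \<Rightarrow> bool" where
  "simple_transcendental_extension e x \<longleftrightarrow>
     field_embedding e \<and>
     ring.transcendental ring_of_type_algebra (range e) x \<and>
     generate_field ring_of_type_algebra (insert x (range e)) = UNIV"

text \<open>
  \<open>v\<close> extends \<open>v\<^sub>0\<close>, where \<open>v\<^sub>0K\<close> is identified with a subgroup of the value group of \<open>v\<close> by means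
  of an embedding \<open>\<phi>\<close> of ordered groups.
\<close>

definition extends_valuation ::
  "('k :: field \<Rightarrow> 'l :: field) \<Rightarrow> ('k \<Rightarrow> 'g :: linordered_ab_group_add extended)
     \<Rightarrow> ('l \<Rightarrow> 'h :: linordered_ab_group_add extended) \<Rightarrow> bool" where
  "extends_valuation e v0 v \<longleftrightarrow>
     (\<exists>\<phi>. (\<forall>\<alpha>\<in>value_group v0. \<forall>\<beta>\<in>value_group v0. \<phi> (\<alpha> + \<beta>) = \<phi> \<alpha> + \<phi> \<beta>) \<and>
          strict_mono_on (value_group v0) \<phi> \<and>
          (\<forall>a \<gamma>. v0 a = Fin \<gamma> \<longrightarrow> v (e a) = Fin (\<phi> \<gamma>)))"

definition dense_in_extension ::
  "('k :: field \<Rightarrow> 'l :: field) \<Rightarrow> ('l \<Rightarrow> 'g :: linordered_ab_group_add extended) \<Rightarrow> bool" where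
  "dense_in_extension e v \<longleftrightarrow> (\<forall>a. \<forall>\<alpha>\<in>value_group v. \<exists>c. Fin \<alpha> < v (a - e c))"


section \<open>Approximation types\<close>

text \<open>
  In the rest \<open>v\<close> is a valuation on the larger field. The value group \<open>vK\<close> of the smaller field is
  \<^term>\<open>value_group (v \<circ> e)\<close>, a subset of \<^term>\<open>value_group v\<close>.
\<close>

definition appr ::
  "('k :: field \<Rightarrow> 'l :: field) \<Rightarrow> ('l \<Rightarrow> 'g :: linordered_ab_group_add extended) \<Rightarrow> 'l \<Rightarrow> 'g \<Rightarrow> 'k set" where
  "appr e v x \<gamma> = {c. Fin \<gamma> \<le> v (x - e c)}"

definition appr_open ::
  "('k :: field \<Rightarrow> 'l :: field) \<Rightarrow> ('l \<Rightarrow> 'g :: linordered_ab_group_add extended) \<Rightarrow> 'l \<Rightarrow> 'g \<Rightarrow> 'k set" where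
  "appr_open e v x \<gamma> = {c. Fin \<gamma> < v (x - e c)}"

definition appr_support ::
  "('k :: field \<Rightarrow> 'l :: field) \<Rightarrow> ('l \<Rightarrow> 'g :: linordered_ab_group_add extended) \<Rightarrow> 'l \<Rightarrow> 'g set" where
  "appr_support e v x = {\<gamma> \<in> value_group (v \<circ> e). appr e v x \<gamma> \<noteq> {}}"

definition appr_immediate ::
  "('k :: field \<Rightarrow> 'l :: field) \<Rightarrow> ('l \<Rightarrow> 'g :: linordered_ab_group_add extended) \<Rightarrow> 'l \<Rightarrow> bool" where
  "appr_immediate e v x \<longleftrightarrow>
     appr_support e v x \<noteq> {} \<and>
     \<Inter> {A. A \<noteq> {} \<and> (\<exists>\<gamma> \<in> value_group (v \<circ> e). A = appr e v x \<gamma> \<or> A = appr_open e v x \<gamma>)} = {}"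

definition appr_transcendental_immediate ::
  "('k :: field \<Rightarrow> 'l :: field) \<Rightarrow> ('l \<Rightarrow> 'g :: linordered_ab_group_add extended) \<Rightarrow> 'l \<Rightarrow> bool" where
  "appr_transcendental_immediate e v x \<longleftrightarrow>
     appr_immediate e v x \<and>
     (\<forall>f :: 'k poly. \<exists>\<delta> \<in> appr_support e v x. \<exists>\<alpha>. \<forall>c \<in> appr e v x \<delta>. v (e (poly f c)) = \<alpha>)"

definition appr_algebraic_immediate ::
  "('k :: field \<Rightarrow> 'l :: field) \<Rightarrow> ('l \<Rightarrow> 'g :: linordered_ab_group_add extended) \<Rightarrow> 'l \<Rightarrow> bool" where
  "appr_algebraic_immediate e v x \<longleftrightarrow>
     appr_immediate e v x \<and> \<not> appr_transcendental_immediate e v x"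

definition algebraic_completion_type ::
  "('k :: field \<Rightarrow> 'l :: field) \<Rightarrow> ('l \<Rightarrow> 'g :: linordered_ab_group_add extended) \<Rightarrow> 'l \<Rightarrow> bool" where
  "algebraic_completion_type e v x \<longleftrightarrow>
     appr_algebraic_immediate e v x \<and> appr_support e v x = value_group (v \<circ> e)"


section \<open>Pure and almost pure extensions\<close>

definition value_transcendental ::
  "('k :: field \<Rightarrow> 'l :: field) \<Rightarrow> ('l \<Rightarrow> 'g :: linordered_ab_group_add extended) \<Rightarrow> 'l \<Rightarrow> bool" where
  "value_transcendental e v t \<longleftrightarrow>
     (\<exists>\<gamma>. v t = Fin \<gamma> \<and> (\<forall>n::nat. n > 0 \<longrightarrow> (\<Sum>i<n. \<gamma>) \<notin> value_group (v \<circ> e)))"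

text \<open>\<open>Kv\<close> is regarded as a subfield of the residue field of the larger field.\<close>

definition residue_transcendental ::
  "('k :: field \<Rightarrow> 'l :: field) \<Rightarrow> ('l \<Rightarrow> 'g :: linordered_ab_group_add extended) \<Rightarrow> 'l \<Rightarrow> bool" where
  "residue_transcendental e v t \<longleftrightarrow>
     v t = 0 \<and>
     ring.transcendental (residue_field v) (residue v ` e ` {a. 0 \<le> v (e a)}) (residue v t)"

definition valuation_transcendental ::
  "('k :: field \<Rightarrow> 'l :: field) \<Rightarrow> ('l \<Rightarrow> 'g :: linordered_ab_group_add extended) \<Rightarrow> 'l \<Rightarrow> bool" where
  "valuation_transcendental e v t \<longleftrightarrow> value_transcendental e v t \<or> residue_transcendental e v t"

definition pure_extension ::
  "('k :: field \<Rightarrow> 'l :: field) \<Rightarrow> ('l \<Rightarrow> 'g :: linordered_ab_group_add extended) \<Rightarrow> 'l \<Rightarrow> bool" where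
  "pure_extension e v x \<longleftrightarrow>
     (\<exists>b d. valuation_transcendental e v (e d * (x - e b))) \<or> appr_transcendental_immediate e v x"

definition almost_pure_extension ::
  "('k :: field \<Rightarrow> 'l :: field) \<Rightarrow> ('l \<Rightarrow> 'g :: linordered_ab_group_add extended) \<Rightarrow> 'l \<Rightarrow> bool" where
  "almost_pure_extension e v x \<longleftrightarrow> pure_extension e v x \<or> algebraic_completion_type e v x"

end

theory Submission
  imports Defs
begin

text \<open>
  Let \<open>w\<close> be an extension of \<open>v0\<close> to the algebraic closure of \<open>K\<close> in which \<open>K\<close> is dense. Density
  lets elements of \<open>K\<close> replace algebraic ones wherever only values and residues matter. A good
  approximation in \<open>K\<close> to an \<open>n\<close>-th root of \<open>a\<close> has \<open>n\<close> times its value equal to \<open>v0 a\<close>, so the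
  value group is divisible (\<open>val_nth_root\<close>). A monic polynomial \<open>f\<close> over the valuation ring has an
  integral root in the closure, and an approximation \<open>c\<close> to it has \<open>v0 (f c) > 0\<close>
  (\<open>approximate_root\<close>); so every nonconstant polynomial over the residue field has a root there.

  For a valuation \<open>v\<close> on \<open>K(x)\<close> the values \<open>v (x - c)\<close>, \<open>c \<in> K\<close>, decide which kind of extension
  it is (\<open>almost_pure\<close>).

  \<^item> Some \<open>v (x - b)\<close> lies outside \<open>vK\<close>. As \<open>vK\<close> is divisible and the value group of \<open>v\<close> is torsion
  free, no positive multiple of \<open>v (x - b)\<close> lies in \<open>vK\<close>: the element is value-transcendental.

  \<^item> The values lie in \<open>vK\<close> and \<open>v (x - b)\<close> is the largest. If \<open>d\<close> has value \<open>- v (x - b)\<close>, the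
  residue of \<open>t = d (x - b)\<close> is not in \<open>Kv\<close>, since for \<open>c \<in> K\<close> with the same residue \<open>b + c / d\<close>
  would be closer to \<open>x\<close> than \<open>b\<close>. As \<open>Kv\<close> is algebraically closed, this residue is transcendental.
  Concretely: if \<open>f\<close> has integral coefficients in \<open>K\<close>, the leading one a unit, and \<open>c\<close> is an
  approximate root, then \<open>f = (X - c) q + f(c)\<close> reduces to \<open>(X - c) q\<close>, and \<open>q\<close> has smaller degree
  (\<open>val_poly_nonpos_if_residue_outside\<close>).

  \<^item> The values lie in \<open>vK\<close> and there is no largest one. Then the approximation type is
  immediate. If its support is not all of \<open>vK\<close>, the values are bounded by some \<open>\<alpha> \<in> vK\<close>. Factor
  \<open>f\<close> over the closure and approximate each root \<open>r\<close> by some \<open>b \<in> K\<close> to within more than \<open>\<alpha>\<close>.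
  Once \<open>c \<in> K\<close> is closer to \<open>x\<close> than \<open>b\<close> is, \<open>c - b\<close> has the value of \<open>x - b\<close>, which is less than
  \<open>\<alpha>\<close>, and so does \<open>c - r\<close>. Hence the value of each factor at \<open>c\<close> becomes constant, and with it
  that of \<open>f c\<close>: the type is transcendental (\<open>transcendental_immediate\<close>). If the support is \<open>vK\<close>,
  the type is transcendental or an algebraic completion type.

  The valuations \<open>w\<close> and \<open>v\<close> live on different fields and are compared through \<open>v0\<close>, on elements of
  \<open>K\<close>; this is why roots are always traded for elements of \<open>K\<close> first.
\<close>

section \<open>Krull valuations\<close>

lemma nfold_sum_inject:
  fixes n :: nat and \<gamma> \<delta> :: "'g :: linordered_ab_group_add"
  assumes "n > 0" and "(\<Sum>i<n. \<gamma>) = (\<Sum>i<n. \<delta>)"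
  shows "\<gamma> = \<delta>"
proof (rule ccontr)
  assume "\<gamma> \<noteq> \<delta>"
  moreover have "(\<Sum>i<n. \<alpha>) < (\<Sum>i<n. \<beta>)" if "\<alpha> < \<beta>" for \<alpha> \<beta> :: 'g
    using that \<open>n > 0\<close> by (intro sum_strict_mono) auto
  ultimately show False
    using assms(2) by (metis less_irrefl neq_iff)
qed

lemma zero_less_infinity [simp]: "(0 :: 'g :: linordered_ab_group_add extended) < \<infinity>"
  by (simp add: zero_extended_def)

lemma zero_neq_infinity [simp]:
  "(0 :: 'g :: linordered_ab_group_add extended) \<noteq> \<infinity>"
  "\<infinity> \<noteq> (0 :: 'g :: linordered_ab_group_add extended)"
  by (simp_all add: zero_extended_def)

context krull_valuation
begin

lemma val_eq_infinity_iff [simp]: "v a = \<infinity> \<longleftrightarrow> a = 0"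
  using val_zero val_nonzero by fastforce

lemma val_one [simp]: "v 1 = 0"
proof -
  obtain \<gamma> where "v 1 = Fin \<gamma>" using val_nonzero[of 1] by auto
  then show ?thesis using val_mult[of 1 1] by (simp add: zero_extended_def)
qed

lemma val_minus [simp]: "v (- a) = v a"
proof -
  obtain \<gamma> where \<gamma>: "v (- 1) = Fin \<gamma>" using val_nonzero[of "- 1"] by auto
  then have "v (- 1) = 0"
    using val_mult[of "- 1" "- 1"] by (simp add: zero_extended_def)
  then show ?thesis using val_mult[of "- 1" a] by simp
qed

lemma val_minus_commute: "v (a - b) = v (b - a)"
  using val_minus[of "a - b"] by simp

lemma val_diff: "min (v a) (v b) \<le> v (a - b)"
  using val_add[of a "- b"] by simp

lemma val_add_eq_left:
  assumes "v a < v b"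
  shows "v (a + b) = v a"
proof (rule antisym)
  show "v a \<le> v (a + b)" using val_add[of a b] assms by simp
  show "v (a + b) \<le> v a" using val_diff[of "a + b" b] assms by (auto simp: min_le_iff_disj)
qed

lemma val_diff_eq_left: "v a < v b \<Longrightarrow> v (a - b) = v a"
  using val_add_eq_left[of a "- b"] by simp

lemma val_power: "v a = Fin \<gamma> \<Longrightarrow> v (a ^ n) = Fin (\<Sum>i<n. \<gamma>)"
  by (induction n) (auto simp: val_mult zero_extended_def algebra_simps)

lemma val_mult_nonneg: "0 \<le> v a \<Longrightarrow> 0 \<le> v b \<Longrightarrow> 0 \<le> v (a * b)"
  using add_mono[of 0 "v a" 0 "v b"] by (simp add: val_mult)

lemma val_mult_pos: "0 < v a \<Longrightarrow> 0 \<le> v b \<Longrightarrow> 0 < v (a * b)"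
  using add_left_mono[of 0 "v b" "v a"] by (simp add: val_mult)

lemma val_add_nonneg: "0 \<le> v a \<Longrightarrow> 0 \<le> v b \<Longrightarrow> 0 \<le> v (a + b)"
  using val_add[of a b] by (auto simp: min_le_iff_disj intro: order_trans)

lemma val_inverse:
  assumes "a \<noteq> 0"
  shows "v a + v (inverse a) = 0"
  using val_mult[of a "inverse a"] assms by simp

lemma val_inverse_unit: "v a = 0 \<Longrightarrow> v (inverse a) = 0"
  using val_inverse[of a] val_zero by (cases "a = 0") auto

lemma val_zero_nonneg [simp]: "0 < v 0" "0 \<le> v 0"
  by (auto simp: val_zero)

end


section \<open>Polynomials over the valuation ring\<close>

context krull_valuation
begin

definition integral_poly :: "'k poly \<Rightarrow> bool" where
  "integral_poly p \<longleftrightarrow> (\<forall>i. 0 \<le> v (Polynomial.coeff p i))"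

lemma integral_poly_pCons [simp]: "integral_poly (pCons a p) \<longleftrightarrow> 0 \<le> v a \<and> integral_poly p"
  by (auto simp: integral_poly_def coeff_pCons split: nat.splits)

lemma integral_poly_0 [simp]: "integral_poly 0"
  by (simp add: integral_poly_def)

lemma val_poly_nonneg: "integral_poly p \<Longrightarrow> 0 \<le> v a \<Longrightarrow> 0 \<le> v (poly p a)"
  by (induction p) (auto intro: val_add_nonneg val_mult_nonneg)

lemma integral_synthetic_div:
  "integral_poly p \<Longrightarrow> 0 \<le> v a \<Longrightarrow> integral_poly (synthetic_div p a)"
  by (induction p) (auto intro: val_poly_nonneg)

text \<open>
  This gives that the valuation ring is integrally closed. The induction runs over Horner's
  scheme: when \<open>v a < 0\<close>, in \<open>b + a * p(a)\<close> the second summand has negative value and dominates the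
  integral \<open>b\<close>.
\<close>

lemma val_monic_poly_nonpos:
  assumes "integral_poly p" "Polynomial.lead_coeff p = 1" "v a < 0"
  shows "v (poly p a) \<le> 0"
  using assms
proof (induction p)
  case (pCons b p)
  show ?case
  proof (cases "p = 0")
    case False
    then have "v (poly p a) \<le> 0" using pCons by simp
    then have "v (a * poly p a) < 0"
      using add_left_mono[of "v (poly p a)" 0 "v a"] \<open>v a < 0\<close> by (simp add: val_mult)
    moreover have "0 \<le> v b" using pCons.prems by simp
    ultimately have "v (a * poly p a + b) = v (a * poly p a)"
      by (intro val_add_eq_left) simp
    then show ?thesis using \<open>v (a * poly p a) < 0\<close> by (simp add: add.commute)
  qed (use pCons.prems in simp)
qed simp

lemma val_root_nonneg:
  assumes "integral_poly p" "Polynomial.lead_coeff p = 1" "poly p a = 0"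
  shows "0 \<le> v a"
  using val_monic_poly_nonpos[OF assms(1,2), of a] assms(3)
  by (auto simp: val_zero not_le[symmetric])

lemma val_poly_near_root:
  assumes "integral_poly p" "poly p a = 0" "0 \<le> v a" "0 < v (c - a)" "0 \<le> v c"
  shows "0 < v (poly p c)"
proof -
  have "poly p c = poly ([:- a, 1:] * synthetic_div p a) c"
    using synthetic_div_correct'[of a p] assms(2) by simp
  also have "\<dots> = (c - a) * poly (synthetic_div p a) c"
    by (simp add: algebra_simps)
  finally show ?thesis
    using assms by (simp add: val_mult_pos val_poly_nonneg integral_synthetic_div)
qed

end

lemma lead_coeff_synthetic_div:
  fixes p :: "'a :: comm_ring_1 poly"
  assumes "Polynomial.degree p > 0"
  shows "Polynomial.lead_coeff (synthetic_div p c) = Polynomial.lead_coeff p"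
  using assms
proof (induction p)
  case (pCons a p)
  show ?case
  proof (cases "Polynomial.degree p = 0")
    case True
    then obtain b where "p = [:b:]" by (rule degree_eq_zeroE)
    then show ?thesis using pCons.prems by auto
  next
    case False
    then have "p \<noteq> 0" "synthetic_div p c \<noteq> 0" by (auto simp: synthetic_div_eq_0_iff)
    then show ?thesis using False pCons.IH by simp
  qed
qed simp


section \<open>The residue field\<close>

context krull_valuation
begin

lemma valuation_ring_simps [simp]:
  "carrier (valuation_ring v) = {a. 0 \<le> v a}"
  "a \<otimes>\<^bsub>valuation_ring v\<^esub> b = a * b"
  "a \<oplus>\<^bsub>valuation_ring v\<^esub> b = a + b"
  "\<one>\<^bsub>valuation_ring v\<^esub> = 1"
  "\<zero>\<^bsub>valuation_ring v\<^esub> = 0"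
  by (simp_all add: valuation_ring_def ring_of_type_algebra_def)

lemma cring_valuation_ring: "cring (valuation_ring v)"
proof (intro cringI abelian_groupI comm_monoidI)
  show "\<exists>b\<in>carrier (valuation_ring v). b \<oplus>\<^bsub>valuation_ring v\<^esub> a = \<zero>\<^bsub>valuation_ring v\<^esub>"
    if "a \<in> carrier (valuation_ring v)" for a
    using that by (intro bexI[of _ "- a"]) auto
qed (auto simp: algebra_simps val_add_nonneg val_mult_nonneg)

lemma ideal_maximal_ideal: "ideal (maximal_ideal v) (valuation_ring v)"
proof -
  interpret R: cring "valuation_ring v" by (rule cring_valuation_ring)
  have add: "0 < v (a + b)" if "0 < v a" "0 < v b" for a b
    using val_add[of a b] that by (auto simp: min_le_iff_disj intro: less_le_trans)
  have "subgroup (maximal_ideal v) (add_monoid (valuation_ring v))"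
  proof (rule R.add.subgroupI)
    show "\<ominus>\<^bsub>valuation_ring v\<^esub> a \<in> maximal_ideal v" if "a \<in> maximal_ideal v" for a
    proof -
      have "\<ominus>\<^bsub>valuation_ring v\<^esub> a = - a"
        using that by (intro R.minus_equality) (auto simp: maximal_ideal_def)
      then show ?thesis using that by (simp add: maximal_ideal_def)
    qed
  qed (auto simp: maximal_ideal_def add intro: exI[of _ 0])
  then show ?thesis
    by (intro idealI R.ring_axioms)
       (auto simp: maximal_ideal_def val_mult_pos mult.commute)
qed

lemma maximalideal_maximal_ideal: "maximalideal (maximal_ideal v) (valuation_ring v)"
proof (intro maximalidealI ideal_maximal_ideal)
  have "1 \<in> carrier (valuation_ring v)" "1 \<notin> maximal_ideal v"
    by (simp_all add: maximal_ideal_def)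
  then show "carrier (valuation_ring v) \<noteq> maximal_ideal v" by blast
  fix J assume J: "ideal J (valuation_ring v)" "maximal_ideal v \<subseteq> J"
    "J \<subseteq> carrier (valuation_ring v)"
  interpret J: ideal J "valuation_ring v" by fact
  show "J = maximal_ideal v \<or> J = carrier (valuation_ring v)"
  proof (cases "J \<subseteq> maximal_ideal v")
    case False
    then obtain a where a: "a \<in> J" "v a = 0"
      using J(3) by (force simp: maximal_ideal_def)
    then have "inverse a \<otimes>\<^bsub>valuation_ring v\<^esub> a \<in> J"
      by (intro J.I_l_closed) (simp_all add: val_inverse_unit)
    moreover have "a \<noteq> 0" using a by (auto simp: val_zero)
    ultimately show ?thesis using J.one_imp_carrier by simp
  qed (use J(2) in blast)
qed

lemma field_residue_field: "field (residue_field v)"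
  unfolding residue_field_def
  by (rule maximalideal.quotient_is_field[OF maximalideal_maximal_ideal cring_valuation_ring])

lemma residue_hom: "ring_hom_ring (valuation_ring v) (residue_field v) (residue v)"
  unfolding residue_field_def residue_def
  by (rule ideal.rcos_ring_hom_ring[OF ideal_maximal_ideal])

lemma carrier_residue_field: "carrier (residue_field v) = residue v ` {a. 0 \<le> v a}"
  unfolding residue_field_def FactRing_def A_RCOSETS_defs residue_def a_r_coset_defs
  by (auto simp: RCOSETS_def)

lemma residue_eq_zero_iff:
  assumes "0 \<le> v a"
  shows "residue v a = \<zero>\<^bsub>residue_field v\<^esub> \<longleftrightarrow> 0 < v a"
proof -
  interpret I: ideal "maximal_ideal v" "valuation_ring v" by (rule ideal_maximal_ideal)
  have "residue v a = \<zero>\<^bsub>residue_field v\<^esub> \<longleftrightarrow> a \<in> maximal_ideal v"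
    using assms I.rcos_const_imp_mem[of a] I.a_rcos_const[of a]
    by (auto simp: residue_def residue_field_def FactRing_def)
  then show ?thesis by (simp add: maximal_ideal_def)
qed

text \<open>
  The library for rings with a carrier represents polynomials by lists that start with the leading
  coefficient, the one for type classes by a type; the reversal translates between the two.
\<close>

lemma eval_residue:
  assumes "set as \<subseteq> {a. 0 \<le> v a}" "0 \<le> v t"
  shows "ring.eval (residue_field v) (map (residue v) as) (residue v t)
           = residue v (poly (Poly (rev as)) t)"
    and "0 \<le> v (poly (Poly (rev as)) t)"
proof -
  interpret h: ring_hom_ring "valuation_ring v" "residue_field v" "residue v"
    by (rule residue_hom)
  have pow: "residue v t [^]\<^bsub>residue_field v\<^esub> n = residue v (t ^ n) \<and> 0 \<le> v (t ^ n)" for n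
    using assms(2) h.hom_mult[of "t ^ m" t for m]
    by (induction n) (auto simp: val_mult_nonneg mult.commute h.hom_one[simplified])
  have "ring.eval (residue_field v) (map (residue v) as) (residue v t)
           = residue v (poly (Poly (rev as)) t) \<and> 0 \<le> v (poly (Poly (rev as)) t)"
    using assms(1)
  proof (induction as)
    case Nil
    then show ?case using h.hom_zero by simp
  next
    case (Cons a as)
    let ?n = "length as"
    have "residue v a \<otimes>\<^bsub>residue_field v\<^esub> residue v (t ^ ?n) = residue v (a * t ^ ?n)"
      using h.hom_mult[of a "t ^ ?n"] pow Cons.prems by simp
    moreover have "0 \<le> v (a * t ^ ?n)"
      using pow Cons.prems by (simp add: val_mult_nonneg)
    ultimately show ?case
      using Cons h.hom_add[of "a * t ^ ?n" "poly (Poly (rev as)) t"] pow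
      by (simp add: Poly_append poly_monom val_add_nonneg algebra_simps)
  qed
  then show "ring.eval (residue_field v) (map (residue v) as) (residue v t)
           = residue v (poly (Poly (rev as)) t)" "0 \<le> v (poly (Poly (rev as)) t)" by auto
qed

end


section \<open>Extensions of valued fields\<close>

locale valued_extension = base: krull_valuation v0 + krull_valuation v
  for v0 :: "'k :: field \<Rightarrow> 'g :: linordered_ab_group_add extended"
    and v :: "'l :: field \<Rightarrow> 'h :: linordered_ab_group_add extended" +
  fixes e :: "'k \<Rightarrow> 'l"
  assumes embedding: "field_embedding e"
    and extends: "extends_valuation e v0 v"
begin

lemma embed_add [simp]: "e (a + b) = e a + e b"
  and embed_mult [simp]: "e (a * b) = e a * e b"
  and embed_one [simp]: "e 1 = 1"
  using embedding by (auto simp: field_embedding_def ring_hom_def ring_of_type_algebra_def)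

lemma embed_zero [simp]: "e 0 = 0"
  by (rule add_left_imp_eq[of "e 0"]) (simp flip: embed_add)

lemma embed_minus [simp]: "e (- a) = - e a"
  using embed_add[of a "- a"] by (simp add: eq_neg_iff_add_eq_0 add.commute)

lemma embed_diff [simp]: "e (a - b) = e a - e b"
  using embed_add[of a "- b"] by simp

lemma embed_power [simp]: "e (a ^ n) = e a ^ n"
  by (induction n) auto

lemma val_embed_le_iff [simp]: "v (e a) \<le> v (e b) \<longleftrightarrow> v0 a \<le> v0 b"
proof -
  obtain \<phi> where mono: "strict_mono_on (value_group v0) \<phi>"
    and \<phi>: "\<And>a \<gamma>. v0 a = Fin \<gamma> \<Longrightarrow> v (e a) = Fin (\<phi> \<gamma>)"
    using extends by (auto simp: extends_valuation_def)
  show ?thesis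
  proof (cases "a = 0 \<or> b = 0")
    case True
    moreover have "v (e c) \<noteq> \<infinity> \<and> v0 c \<noteq> \<infinity>" if "c \<noteq> 0" for c
      using base.val_nonzero[OF that] \<phi> by fastforce
    ultimately show ?thesis
      by (cases "a = 0"; cases "b = 0") (simp_all add: val_zero base.val_zero)
  next
    case False
    then obtain \<alpha> \<beta> where "v0 a = Fin \<alpha>" "v0 b = Fin \<beta>"
      using base.val_nonzero by metis
    moreover from this have "\<alpha> \<in> value_group v0" "\<beta> \<in> value_group v0"
      by (auto simp: value_group_def intro: range_eqI[OF sym])
    ultimately show ?thesis
      using strict_mono_on_less_eq[OF mono, of \<alpha> \<beta>] \<phi> by simp
  qed
qed

lemma val_embed_less_iff [simp]: "v (e a) < v (e b) \<longleftrightarrow> v0 a < v0 b"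
  by (simp add: not_le[symmetric])

lemma val_embed_eq_iff [simp]: "v (e a) = v (e b) \<longleftrightarrow> v0 a = v0 b"
  by (simp add: eq_iff)

lemma val_embed_nonneg_iff [simp]: "0 \<le> v (e a) \<longleftrightarrow> 0 \<le> v0 a"
  using val_embed_le_iff[of 1 a] by simp

lemma val_embed_pos_iff [simp]: "0 < v (e a) \<longleftrightarrow> 0 < v0 a"
  using val_embed_less_iff[of 1 a] by simp

lemma val_embed_eq_zero_iff [simp]: "v (e a) = 0 \<longleftrightarrow> v0 a = 0"
  using val_embed_eq_iff[of a 1] by simp

lemma embed_eq_zero_iff [simp]: "e a = 0 \<longleftrightarrow> a = 0"
  using val_embed_eq_iff[of a 0] by (simp add: val_zero base.val_zero)

lemma embed_poly: "poly (map_poly e p) (e a) = e (poly p a)"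
  by (induction p) (auto simp: map_poly_pCons)

lemma degree_embed_poly: "Polynomial.degree (map_poly e p) = Polynomial.degree p"
  by (simp add: degree_map_poly)

lemma lead_coeff_embed_poly:
  "Polynomial.lead_coeff (map_poly e p) = e (Polynomial.lead_coeff p)"
  by (simp add: coeff_map_poly degree_map_poly)

lemma integral_poly_embed [simp]: "integral_poly (map_poly e p) \<longleftrightarrow> base.integral_poly p"
  by (simp add: integral_poly_def base.integral_poly_def coeff_map_poly)

lemma embed_synthetic_div:
  "poly (map_poly e p) t = (t - e c) * poly (map_poly e (synthetic_div p c)) t + e (poly p c)"
proof (induction p)
  case (pCons a p)
  let ?Q = "poly (map_poly e (synthetic_div p c)) t"
  have "poly (map_poly e (pCons a p)) t = e a + t * ((t - e c) * ?Q + e (poly p c))"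
    using pCons.IH by (simp add: map_poly_pCons)
  also have "\<dots> = (t - e c) * (e (poly p c) + t * ?Q) + (e a + e c * e (poly p c))"
    by (simp add: algebra_simps)
  finally show ?case by (simp add: map_poly_pCons)
qed simp

text \<open>
  Choosing integral representatives of the coefficients turns a nonzero polynomial over \<open>Kv\<close> into
  a polynomial over \<open>K\<close> of the same degree. Its leading coefficient is a unit because the leading
  residue is not zero.
\<close>

lemma lift_residue_poly:
  assumes p: "set p \<subseteq> residue v ` e ` {a. 0 \<le> v (e a)}" "p \<noteq> []"
    and hd: "hd p \<noteq> \<zero>\<^bsub>residue_field v\<^esub>"
  obtains f where "base.integral_poly f" "v0 (Polynomial.lead_coeff f) = 0"
    and "Polynomial.degree f = length p - 1"
    and "\<And>t. 0 \<le> v t \<Longrightarrow> 0 \<le> v (poly (map_poly e f) t) \<and>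
           ring.eval (residue_field v) p (residue v t) = residue v (poly (map_poly e f) t)"
proof -
  have "p \<in> lists ((\<lambda>a. residue v (e a)) ` {a. 0 \<le> v0 a})"
    using p(1) by (auto simp: image_image)
  then obtain as where as: "set as \<subseteq> {a. 0 \<le> v0 a}" and p_eq: "p = map (\<lambda>a. residue v (e a)) as"
    unfolding lists_image by blast
  have "as \<noteq> []" using p(2) p_eq by simp
  define f where "f = Poly (rev as)"
  have hd_nonneg: "0 \<le> v0 (hd as)"
    using as \<open>as \<noteq> []\<close> hd_in_set by blast
  have "residue v (e (hd as)) \<noteq> \<zero>\<^bsub>residue_field v\<^esub>"
    using hd p_eq \<open>as \<noteq> []\<close> by (simp add: hd_map)
  then have hd_as: "v0 (hd as) = 0"
    using residue_eq_zero_iff[of "e (hd as)"] hd_nonneg by simp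
  then have "hd as \<noteq> 0" by (auto simp: base.val_zero)
  then have coeffs: "coeffs f = rev as"
    using \<open>as \<noteq> []\<close> by (cases as) (simp_all add: f_def strip_while_def)
  have "base.integral_poly f"
    unfolding base.integral_poly_def
  proof
    fix i
    have "nth_default 0 (rev as) i \<in> insert 0 (set as)"
      using nth_mem[of i "rev as"] by (simp add: nth_default_def)
    then show "0 \<le> v0 (Polynomial.coeff f i)"
      using as by (auto simp: f_def)
  qed
  moreover have "v0 (Polynomial.lead_coeff f) = 0"
    using hd_as \<open>as \<noteq> []\<close> coeffs last_coeffs_eq_coeff_degree[of f]
    by (cases "f = 0") (simp_all add: last_rev)
  moreover have "Polynomial.degree f = length p - 1"
    using p_eq coeffs by (simp add: degree_eq_length_coeffs)
  moreover have "map_poly e f = Poly (rev (map e as))"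
    using coeffs by (simp add: map_poly_def rev_map)
  then have "0 \<le> v (poly (map_poly e f) t) \<and>
      ring.eval (residue_field v) p (residue v t) = residue v (poly (map_poly e f) t)"
    if "0 \<le> v t" for t
  proof -
    have "set (map e as) \<subseteq> {a. 0 \<le> v a}" using as by auto
    then show ?thesis
      using eval_residue[of "map e as" t] \<open>map_poly e f = _\<close> that by (simp add: p_eq comp_def)
  qed
  ultimately show thesis by (rule that)
qed

end

text \<open>
  Regarding \<open>K\<close> as an extension of itself, \<open>lift_residue_poly\<close> also applies to the residue field of
  \<open>K\<close>.
\<close>

lemma (in krull_valuation) valued_extension_self: "valued_extension v v (\<lambda>a. a)"
  by unfold_locales
     (auto simp: field_embedding_def ring_hom_def extends_valuation_def strict_mono_on_def
       intro!: exI[of _ "\<lambda>\<gamma>. \<gamma>"])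


section \<open>Fields that are dense in their algebraic closure\<close>

locale dense_in_closure = valued_extension v0 w to_ac
  for v0 :: "'k :: field \<Rightarrow> 'g :: linordered_ab_group_add extended"
    and w :: "'k alg_closure \<Rightarrow> 'h :: linordered_ab_group_add extended" +
  assumes dense: "dense_in_extension to_ac w"
begin

lemma approximation:
  assumes "d \<noteq> 0"
  obtains c where "w d < w (a - to_ac c)"
proof -
  obtain \<alpha> where \<alpha>: "w d = Fin \<alpha>" using val_nonzero assms by blast
  then have "\<alpha> \<in> value_group w" by (auto simp: value_group_def intro: range_eqI[OF sym])
  then obtain c where "Fin \<alpha> < w (a - to_ac c)"
    using dense unfolding dense_in_extension_def by blast
  with \<alpha> show thesis using that by simp
qed

text \<open>
  For \<open>a \<noteq> 0\<close> there is \<open>b \<in> K\<close> closer to a root of \<open>X ^ n - a\<close> than \<open>0\<close> is, and it has the value of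
  that root.
\<close>

lemma val_nth_root:
  assumes "n > 0"
  shows "\<exists>b. v0 (b ^ n) = v0 a"
proof (cases "a = 0")
  case True
  then show ?thesis using assms by (intro exI[of _ 0]) (simp add: zero_power)
next
  case False
  obtain r where r: "r ^ n = to_ac a"
    using nth_root_exists[OF assms] by blast
  with False have "r \<noteq> 0" using assms by (auto simp: zero_power)
  then obtain c where "w r < w (r - to_ac c)" by (rule approximation)
  then have eq: "w (to_ac c) = w r"
    using val_diff_eq_left[of r "r - to_ac c"] by simp
  obtain \<gamma> where "w r = Fin \<gamma>" using val_nonzero \<open>r \<noteq> 0\<close> by blast
  then have "w (to_ac c ^ n) = w (to_ac a)"
    using eq r val_power by metis
  then have "w (to_ac (c ^ n)) = w (to_ac a)" by simp
  then show ?thesis unfolding val_embed_eq_iff by blast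
qed

lemma divisible_value_group: "divisible (value_group v0)"
  unfolding divisible_def
proof (intro ballI allI impI)
  fix \<gamma> and n :: nat
  assume "\<gamma> \<in> value_group v0" and n: "n > 0"
  then obtain a where a: "v0 a = Fin \<gamma>" by (auto simp: value_group_def)
  obtain b where b: "v0 (b ^ n) = Fin \<gamma>" using val_nth_root[OF n, of a] a by auto
  have "b \<noteq> 0" using b n by (auto simp: zero_power base.val_zero)
  then obtain \<delta> where \<delta>: "v0 b = Fin \<delta>" using base.val_nonzero by blast
  then have "(\<Sum>i<n. \<delta>) = \<gamma>" using base.val_power[OF \<delta>, of n] b by simp
  moreover have "\<delta> \<in> value_group v0"
    using \<delta> by (auto simp: value_group_def intro: range_eqI[OF sym])
  ultimately show "\<exists>\<delta>\<in>value_group v0. (\<Sum>i<n. \<delta>) = \<gamma>" by blast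
qed

text \<open>
  A root in the algebraic closure is integral. Density gives \<open>c \<in> K\<close> congruent to it modulo the
  maximal ideal, and then \<open>f c\<close> is congruent to \<open>0\<close>.
\<close>

lemma approximate_root:
  assumes "base.integral_poly f" "Polynomial.lead_coeff f = 1" "Polynomial.degree f > 0"
  obtains c where "0 \<le> v0 c" "0 < v0 (poly f c)"
proof -
  let ?F = "map_poly to_ac f"
  have F: "integral_poly ?F" "Polynomial.lead_coeff ?F = 1" "Polynomial.degree ?F > 0"
    using assms lead_coeff_embed_poly[of f] by (simp_all add: degree_embed_poly)
  obtain r where r: "poly ?F r = 0"
    using alg_closed_imp_poly_has_root[OF F(3)] by blast
  have r0: "0 \<le> w r" by (rule val_root_nonneg[OF F(1,2) r])
  obtain c where "w 1 < w (r - to_ac c)" using approximation[of 1 r] by auto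
  then have c: "0 < w (to_ac c - r)" by (simp add: val_minus_commute)
  have c0: "0 \<le> w (to_ac c)"
    using val_add_nonneg[of "to_ac c - r" r] c r0 by simp
  have "0 < w (poly ?F (to_ac c))"
    by (rule val_poly_near_root[OF F(1) r r0 c c0])
  then have "0 < v0 (poly f c)" by (simp add: embed_poly)
  with c0 show thesis using that by simp
qed

lemma approximate_root_unit_lead_coeff:
  assumes "base.integral_poly f" "v0 (Polynomial.lead_coeff f) = 0" "Polynomial.degree f > 0"
  obtains c where "0 \<le> v0 c" "0 < v0 (poly f c)"
proof -
  let ?u = "inverse (Polynomial.lead_coeff f)"
  have nz: "Polynomial.lead_coeff f \<noteq> 0" using assms(3) by auto
  have u: "v0 ?u = 0" using assms(2) by (rule base.val_inverse_unit)
  then have "base.integral_poly (smult ?u f)"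
    using assms(1) by (auto simp: base.integral_poly_def base.val_mult_nonneg)
  moreover have "Polynomial.lead_coeff (smult ?u f) = 1" using nz by simp
  moreover have "Polynomial.degree (smult ?u f) > 0" using nz assms(3) by simp
  ultimately obtain c where "0 \<le> v0 c" "0 < v0 (poly (smult ?u f) c)"
    by (rule approximate_root)
  with u show thesis using that by (simp add: base.val_mult)
qed

lemma algebraically_closed_residue_field: "algebraically_closed (residue_field v0)"
proof -
  interpret R: field "residue_field v0" by (rule base.field_residue_field)
  show ?thesis
  proof (rule R.algebraically_closedI)
    fix p assume p: "p \<in> carrier (poly_ring (residue_field v0))" and deg: "length p - 1 > 1"
    have "p \<noteq> []" using deg by auto
    moreover have "set p \<subseteq> residue v0 ` (\<lambda>a. a) ` {a. 0 \<le> v0 a}" "hd p \<noteq> \<zero>\<^bsub>residue_field v0\<^esub>"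
      using p deg by (auto simp: univ_poly_def polynomial_def base.carrier_residue_field)
    ultimately obtain f where f: "base.integral_poly f" "v0 (Polynomial.lead_coeff f) = 0"
      "Polynomial.degree f = length p - 1"
      and eval: "\<And>t. 0 \<le> v0 t \<Longrightarrow> 0 \<le> v0 (poly f t) \<and>
           ring.eval (residue_field v0) p (residue v0 t) = residue v0 (poly f t)"
      using valued_extension.lift_residue_poly[OF base.valued_extension_self, of p]
      unfolding map_poly_id' by metis
    obtain c where c: "0 \<le> v0 c" "0 < v0 (poly f c)"
      using approximate_root_unit_lead_coeff[OF f(1,2)] f(3) deg by force
    then have "R.eval p (residue v0 c) = \<zero>\<^bsub>residue_field v0\<^esub>"
      using eval[OF c(1)] base.residue_eq_zero_iff by simp
    with c(1) show "\<exists>x\<in>carrier (residue_field v0). R.eval p x = \<zero>\<^bsub>residue_field v0\<^esub>"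
      by (auto simp: base.carrier_residue_field)
  qed
qed

end


section \<open>Values and residues outside the smaller field\<close>

locale dense_extension = ac: dense_in_closure v0 w + valued_extension v0 v e
  for v0 :: "'k :: field \<Rightarrow> 'g :: linordered_ab_group_add extended"
    and w :: "'k alg_closure \<Rightarrow> 'h :: linordered_ab_group_add extended"
    and v :: "'l :: field \<Rightarrow> 'i :: linordered_ab_group_add extended"
    and e :: "'k \<Rightarrow> 'l"
begin

lemma mem_value_group_iff: "\<gamma> \<in> value_group (v \<circ> e) \<longleftrightarrow> (\<exists>a. v (e a) = Fin \<gamma>)"
  by (auto simp: value_group_def intro: range_eqI[OF sym])

text \<open>
  If \<open>n\<close> times \<open>\<gamma>\<close> is a value \<open>v a\<close> with \<open>a \<in> K\<close>, an approximate \<open>n\<close>-th root of \<open>a\<close> in \<open>K\<close> has a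
  value with the same \<open>n\<close>-th multiple, hence the value \<open>\<gamma>\<close>.
\<close>

lemma value_transcendental_if_not_in_value_group:
  assumes "v t = Fin \<gamma>" "\<gamma> \<notin> value_group (v \<circ> e)"
  shows "value_transcendental e v t"
proof -
  have "(\<Sum>i<n. \<gamma>) \<notin> value_group (v \<circ> e)" if n: "n > 0" for n :: nat
  proof
    assume "(\<Sum>i<n. \<gamma>) \<in> value_group (v \<circ> e)"
    then obtain a where a: "v (e a) = Fin (\<Sum>i<n. \<gamma>)" by (auto simp: mem_value_group_iff)
    obtain b where "v0 (b ^ n) = v0 a" using ac.val_nth_root[OF n] by blast
    then have b: "v (e b ^ n) = Fin (\<Sum>i<n. \<gamma>)"
      using a val_embed_eq_iff[of "b ^ n" a] by simp
    then have "e b \<noteq> 0" using n by (auto simp: val_zero zero_power)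
    then obtain \<delta> where \<delta>: "v (e b) = Fin \<delta>" using val_nonzero by blast
    then have "(\<Sum>i<n. \<delta>) = (\<Sum>i<n. \<gamma>)" using val_power[OF \<delta>, of n] b by simp
    then have "\<delta> = \<gamma>" by (rule nfold_sum_inject[OF n])
    with \<delta> assms(2) show False by (auto simp: mem_value_group_iff)
  qed
  with assms(1) show ?thesis by (auto simp: value_transcendental_def)
qed

text \<open>
  For integral \<open>t\<close>, the hypothesis on \<open>t\<close> says that its residue is not the residue of an element of
  \<open>K\<close>, and the conclusion that this residue is no root of the reduction of \<open>f\<close>. An
  approximate root \<open>c\<close> of \<open>f\<close> splits off a factor \<open>t - c\<close> of nonpositive value, and the remainder
  \<open>f c\<close> is too small to matter.
\<close>

lemma val_poly_nonpos_if_residue_outside: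
  assumes t: "\<And>c. v (t - e c) \<le> 0"
    and f: "ac.base.integral_poly f" "v0 (Polynomial.lead_coeff f) = 0"
  shows "v (poly (map_poly e f) t) \<le> 0"
  using f
proof (induction "Polynomial.degree f" arbitrary: f)
  case 0
  then obtain b where "f = [:b:]" by (metis degree_eq_zeroE)
  with 0 have "v (e b) = 0" by simp
  moreover have "poly (map_poly e f) t = e b"
    by (simp add: \<open>f = [:b:]\<close> map_poly_pCons)
  ultimately show ?case by (metis order_refl)
next
  case (Suc n)
  obtain c where c: "0 \<le> v0 c" "0 < v0 (poly f c)"
    using ac.approximate_root_unit_lead_coeff[OF Suc.prems] Suc.hyps(2) by auto
  let ?q = "synthetic_div f c"
  have q: "v (poly (map_poly e ?q) t) \<le> 0"
  proof (rule Suc.hyps(1))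
    show "n = Polynomial.degree ?q" using Suc.hyps(2) by (simp add: degree_synthetic_div)
    show "ac.base.integral_poly ?q"
      using Suc.prems(1) c(1) by (rule ac.base.integral_synthetic_div)
    have "Polynomial.lead_coeff ?q = Polynomial.lead_coeff f"
      using Suc.hyps(2) by (intro lead_coeff_synthetic_div) simp
    then show "v0 (Polynomial.lead_coeff ?q) = 0" using Suc.prems(2) by (simp only:)
  qed
  have nonpos: "v ((t - e c) * poly (map_poly e ?q) t) \<le> 0"
    using add_mono[OF t[of c] q] by (simp add: val_mult)
  then have "v ((t - e c) * poly (map_poly e ?q) t + e (poly f c))
      = v ((t - e c) * poly (map_poly e ?q) t)"
    using c(2) by (intro val_add_eq_left) (simp add: le_less_trans)
  then show ?case using nonpos by (simp add: embed_synthetic_div[of f t c])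
qed

text \<open>
  An algebraic equation for the residue of \<open>t\<close> lifts to a polynomial whose value at \<open>t\<close> is positive,
  against \<open>val_poly_nonpos_if_residue_outside\<close>.
\<close>

lemma residue_transcendental_if_residue_outside:
  assumes t: "v t = 0" "\<And>c. v (t - e c) \<le> 0"
  shows "residue_transcendental e v t"
proof -
  let ?R = "residue_field v" and ?K = "residue v ` e ` {a. 0 \<le> v (e a)}"
  interpret R: field ?R by (rule field_residue_field)
  interpret h: ring_hom_ring "valuation_ring v" ?R "residue v" by (rule residue_hom)
  have "subring (e ` {a. 0 \<le> v (e a)}) (valuation_ring v)"
  proof (rule h.R.subringI)
    fix x y assume "x \<in> e ` {a. 0 \<le> v (e a)}" "y \<in> e ` {a. 0 \<le> v (e a)}"
    then obtain a b where ab: "x = e a" "y = e b" "0 \<le> v0 a" "0 \<le> v0 b" by auto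
    have "x * y = e (a * b)" "x + y = e (a + b)" "- x = e (- a)" using ab by simp_all
    moreover have "0 \<le> v0 (a * b)" "0 \<le> v0 (a + b)" "0 \<le> v0 (- a)"
      using ab by (simp_all add: ac.base.val_mult_nonneg ac.base.val_add_nonneg)
    moreover have "\<ominus>\<^bsub>valuation_ring v\<^esub> x = - x"
      using ab by (intro h.R.minus_equality) auto
    ultimately show "x \<otimes>\<^bsub>valuation_ring v\<^esub> y \<in> e ` {a. 0 \<le> v (e a)}"
      "x \<oplus>\<^bsub>valuation_ring v\<^esub> y \<in> e ` {a. 0 \<le> v (e a)}"
      "\<ominus>\<^bsub>valuation_ring v\<^esub> x \<in> e ` {a. 0 \<le> v (e a)}"
      unfolding valuation_ring_simps by (auto simp del: embed_add embed_mult embed_minus)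
  qed (auto intro: image_eqI[of _ _ 1])
  then have K: "subring ?K ?R" by (rule h.img_is_subring)
  have carrier: "residue v t \<in> carrier ?R" using t(1) by (auto simp: carrier_residue_field)
  have "R.transcendental ?K (residue v t)"
  proof (rule ccontr)
    assume "\<not> R.transcendental ?K (residue v t)"
    then obtain p where p: "p \<in> carrier (?K[X]\<^bsub>?R\<^esub>)" "p \<noteq> []"
      "R.eval p (residue v t) = \<zero>\<^bsub>?R\<^esub>"
      using R.algebraicE[OF K carrier] by (auto simp: over_def)
    then have "set p \<subseteq> ?K" "hd p \<noteq> \<zero>\<^bsub>?R\<^esub>"
      by (auto simp: univ_poly_def polynomial_def)
    then obtain f where f: "ac.base.integral_poly f" "v0 (Polynomial.lead_coeff f) = 0"
      and eval: "\<And>t. 0 \<le> v t \<Longrightarrow> 0 \<le> v (poly (map_poly e f) t) \<and>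
           R.eval p (residue v t) = residue v (poly (map_poly e f) t)"
      using lift_residue_poly[OF _ p(2)] by metis
    have "0 < v (poly (map_poly e f) t)"
      using eval[of t] t(1) p(3) residue_eq_zero_iff[of "poly (map_poly e f) t"] by simp
    then show False
      using val_poly_nonpos_if_residue_outside[OF t(2) f] by simp
  qed
  with t(1) show ?thesis by (simp add: residue_transcendental_def)
qed

lemma appr_antimono: "\<gamma> \<le> \<delta> \<Longrightarrow> appr e v x \<delta> \<subseteq> appr e v x \<gamma>"
  unfolding appr_def by (force intro: order_trans[of "Fin \<gamma>" "Fin \<delta>"])

lemma appr_support_eq: "appr_support e v x = {\<gamma> \<in> value_group (v \<circ> e). \<exists>c. Fin \<gamma> \<le> v (x - e c)}"
  by (auto simp: appr_support_def appr_def)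

end


section \<open>Elements without a best approximation\<close>

locale no_best_approximation = dense_extension v0 w v e
  for v0 :: "'k :: field \<Rightarrow> 'g :: linordered_ab_group_add extended"
    and w :: "'k alg_closure \<Rightarrow> 'h :: linordered_ab_group_add extended"
    and v :: "'l :: field \<Rightarrow> 'i :: linordered_ab_group_add extended"
    and e :: "'k \<Rightarrow> 'l" +
  fixes x :: 'l
  assumes value_attained: "\<exists>\<gamma>\<in>value_group (v \<circ> e). v (x - e c) = Fin \<gamma>"
    and better: "\<exists>c'. v (x - e c) < v (x - e c')"
begin

text \<open>
  The open ball about \<open>x\<close> of radius \<open>v (x - c)\<close> omits \<open>c\<close>, but contains every better
  approximation.
\<close>

lemma immediate: "appr_immediate e v x"
  unfolding appr_immediate_def
proof
  obtain \<gamma> where "\<gamma> \<in> value_group (v \<circ> e)" "v (x - e 0) = Fin \<gamma>" using value_attained by blast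
  then have "\<gamma> \<in> appr_support e v x"
    unfolding appr_support_eq by (force intro!: exI[of _ 0])
  then show "appr_support e v x \<noteq> {}" by blast
  have "\<exists>A. A \<noteq> {} \<and> (\<exists>\<gamma>\<in>value_group (v \<circ> e). A = appr e v x \<gamma> \<or> A = appr_open e v x \<gamma>) \<and> c \<notin> A"
    for c
  proof -
    obtain \<gamma> where \<gamma>: "\<gamma> \<in> value_group (v \<circ> e)" "v (x - e c) = Fin \<gamma>" using value_attained by blast
    obtain c' where "v (x - e c) < v (x - e c')" using better by blast
    then have "c' \<in> appr_open e v x \<gamma>" "c \<notin> appr_open e v x \<gamma>"
      using \<gamma> by (simp_all add: appr_open_def)
    with \<gamma>(1) show ?thesis by blast
  qed
  then show "\<Inter> {A. A \<noteq> {} \<and> (\<exists>\<gamma>\<in>value_group (v \<circ> e).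
      A = appr e v x \<gamma> \<or> A = appr_open e v x \<gamma>)} = {}"
    by blast
qed

text \<open>
  The root \<open>r\<close> is replaced by an approximation \<open>b \<in> K\<close>, chosen closer to \<open>r\<close> than \<open>x\<close> can be to any
  element of \<open>K\<close>. For \<open>c\<close> closer to \<open>x\<close> than \<open>b\<close>, the value of \<open>c - b\<close> is that of \<open>x - b\<close>, and
  this is smaller than that of \<open>r - b\<close>, so \<open>c - r\<close> has the same value as \<open>c - b\<close>.
\<close>

lemma eventually_constant_linear:
  assumes bound: "\<And>c. v (x - e c) < v (e d)" and "d \<noteq> 0"
  shows "\<exists>\<delta>\<in>appr_support e v x. \<exists>\<beta>. \<forall>c\<in>appr e v x \<delta>. w (to_ac c - r) = \<beta>"
proof -
  obtain b where b: "w (to_ac d) < w (r - to_ac b)"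
    using ac.approximation[of "to_ac d"] \<open>d \<noteq> 0\<close> by auto
  obtain b' where b': "v (x - e b) < v (x - e b')" using better by blast
  obtain \<delta> where \<delta>: "\<delta> \<in> value_group (v \<circ> e)" "v (x - e b') = Fin \<delta>" using value_attained by blast
  have dist: "v (e (c - b)) = v (x - e b)" if "c \<in> appr e v x \<delta>" for c
  proof -
    have "v (x - e b) < v (x - e c)"
      using that b' \<delta>(2) by (auto simp: appr_def intro: less_le_trans)
    then have "v ((x - e b) - (x - e c)) = v (x - e b)" by (rule val_diff_eq_left)
    then show ?thesis by simp
  qed
  have eq: "w (to_ac c - r) = w (to_ac (c - b))" if c: "c \<in> appr e v x \<delta>" for c
  proof -
    have "v0 (c - b) < v0 d"
      using dist[OF c] bound[of b] val_embed_less_iff[of "c - b" d] by simp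
    then have "w (to_ac (c - b)) < w (r - to_ac b)"
      using b ac.val_embed_less_iff[of "c - b" d] by (auto intro: less_trans)
    then have "w (to_ac (c - b) - (r - to_ac b)) = w (to_ac (c - b))"
      by (rule ac.val_diff_eq_left)
    then show ?thesis by simp
  qed
  have b'_mem: "b' \<in> appr e v x \<delta>" using \<delta>(2) by (simp add: appr_def)
  have "w (to_ac c - r) = w (to_ac (b' - b))" if c: "c \<in> appr e v x \<delta>" for c
  proof -
    have "v0 (c - b) = v0 (b' - b)"
      using dist[OF c] dist[OF b'_mem] val_embed_eq_iff by metis
    then show ?thesis using eq[OF c] ac.val_embed_eq_iff by metis
  qed
  moreover have "\<delta> \<in> appr_support e v x"
    using \<delta>(1) b'_mem by (auto simp: appr_support_def)
  ultimately show ?thesis by blast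
qed

text \<open>
  Over the algebraic closure the polynomial is a product of linear factors. The sets
  \<open>appr e v x \<delta>\<close> shrink as \<open>\<delta>\<close> grows, so the larger of two radii works for both factors.
\<close>

lemma eventually_constant_poly:
  assumes bound: "\<And>c. v (x - e c) < v (e d)" and d: "d \<noteq> 0"
  shows "\<exists>\<delta>\<in>appr_support e v x. \<exists>\<beta>. \<forall>c\<in>appr e v x \<delta>. w (poly g (to_ac c)) = \<beta>"
proof (induction "Polynomial.degree g" arbitrary: g)
  case 0
  then obtain k where "g = [:k:]" by (metis degree_eq_zeroE)
  moreover have "appr_support e v x \<noteq> {}" using immediate by (simp add: appr_immediate_def)
  ultimately show ?case by auto
next
  case (Suc n)
  then obtain r where r: "poly g r = 0" using alg_closed_imp_poly_has_root[of g] by auto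
  let ?h = "synthetic_div g r"
  have g: "poly g y = (y - r) * poly ?h y" for y
  proof -
    have "poly g y = poly ([:- r, 1:] * ?h) y"
      using synthetic_div_correct'[of r g] r by simp
    then show ?thesis by (simp add: algebra_simps)
  qed
  obtain \<delta>1 \<beta>1 where 1: "\<delta>1 \<in> appr_support e v x"
    "\<And>c. c \<in> appr e v x \<delta>1 \<Longrightarrow> w (to_ac c - r) = \<beta>1"
    using eventually_constant_linear[OF bound d, of r] by blast
  obtain \<delta>2 \<beta>2 where 2: "\<delta>2 \<in> appr_support e v x"
    "\<And>c. c \<in> appr e v x \<delta>2 \<Longrightarrow> w (poly ?h (to_ac c)) = \<beta>2"
  proof -
    have "n = Polynomial.degree ?h" using Suc.hyps(2) by (simp add: degree_synthetic_div)
    from Suc.hyps(1)[OF this] show thesis using that by blast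
  qed
  have "max \<delta>1 \<delta>2 \<in> appr_support e v x" using 1(1) 2(1) by (simp add: max_def)
  moreover have "w (poly g (to_ac c)) = \<beta>1 + \<beta>2" if "c \<in> appr e v x (max \<delta>1 \<delta>2)" for c
  proof -
    have "c \<in> appr e v x \<delta>1" "c \<in> appr e v x \<delta>2"
      using that appr_antimono[of \<delta>1 "max \<delta>1 \<delta>2" x] appr_antimono[of \<delta>2 "max \<delta>1 \<delta>2" x] by auto
    then show ?thesis using 1(2) 2(2) by (simp add: g ac.val_mult)
  qed
  ultimately show ?case by blast
qed

lemma transcendental_immediate:
  assumes "appr_support e v x \<noteq> value_group (v \<circ> e)"
  shows "appr_transcendental_immediate e v x"
proof -
  obtain \<alpha> where "\<alpha> \<in> value_group (v \<circ> e)" "\<alpha> \<notin> appr_support e v x"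
    using assms by (auto simp: appr_support_def)
  then obtain d where d: "v (e d) = Fin \<alpha>" and bound: "\<And>c. v (x - e c) < v (e d)"
    by (force simp: appr_support_eq mem_value_group_iff not_le)
  have "d \<noteq> 0" using d by (auto simp: val_zero)
  have "\<exists>\<delta>\<in>appr_support e v x. \<exists>\<alpha>. \<forall>c\<in>appr e v x \<delta>. v (e (poly f c)) = \<alpha>" for f
  proof -
    obtain \<delta> \<beta> where \<delta>: "\<delta> \<in> appr_support e v x"
      and \<beta>: "\<And>c. c \<in> appr e v x \<delta> \<Longrightarrow> w (poly (map_poly to_ac f) (to_ac c)) = \<beta>"
      using eventually_constant_poly[OF bound \<open>d \<noteq> 0\<close>, of "map_poly to_ac f"] by blast
    obtain b where b: "b \<in> appr e v x \<delta>" using \<delta> by (auto simp: appr_support_def)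
    have "v (e (poly f c)) = v (e (poly f b))" if "c \<in> appr e v x \<delta>" for c
    proof -
      have "w (to_ac (poly f c)) = w (to_ac (poly f b))"
        using \<beta>[OF that] \<beta>[OF b] by (simp only: ac.embed_poly)
      then show ?thesis by simp
    qed
    with \<delta> show ?thesis by blast
  qed
  with immediate show ?thesis by (simp add: appr_transcendental_immediate_def)
qed

end


section \<open>Almost pure extensions\<close>

context dense_extension
begin

lemma almost_pure:
  assumes x: "x \<notin> range e"
  shows "almost_pure_extension e v x"
proof -
  have fin: "\<exists>\<gamma>. v (x - e b) = Fin \<gamma>" for b
    using x by (intro val_nonzero) auto
  consider b \<gamma> where "v (x - e b) = Fin \<gamma>" "\<gamma> \<notin> value_group (v \<circ> e)"
    | b \<gamma> where "v (x - e b) = Fin \<gamma>" "\<gamma> \<in> value_group (v \<circ> e)" "\<And>c. v (x - e c) \<le> v (x - e b)"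
    | "\<And>b. \<exists>\<gamma>\<in>value_group (v \<circ> e). v (x - e b) = Fin \<gamma>"
      "\<And>b. \<exists>c. v (x - e b) < v (x - e c)"
    using fin by (metis not_le)
  then show ?thesis
  proof cases
    case 1
    then have "value_transcendental e v (e 1 * (x - e b))"
      by (intro value_transcendental_if_not_in_value_group) simp_all
    then show ?thesis
      unfolding almost_pure_extension_def pure_extension_def valuation_transcendental_def by blast
  next
    case 2
    obtain a where a: "v (e a) = v (x - e b)" using 2 by (auto simp: mem_value_group_iff)
    then have "a \<noteq> 0" using 2 by (auto simp: val_zero)
    let ?d = "inverse a" and ?t = "e (inverse a) * (x - e b)"
    have d: "v (e a) + v (e ?d) = 0"
      using \<open>a \<noteq> 0\<close> val_mult[of "e a" "e ?d"] by (simp flip: embed_mult)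
    \<comment> \<open>Otherwise \<open>b + a * c\<close> would be a better approximation to \<open>x\<close> than \<open>b\<close>.\<close>
    have "v (?t - e c) \<le> 0" for c
    proof -
      have "?t - e c = e ?d * (x - e (b + a * c))"
      proof -
        have "e ?d * e a = 1" using \<open>a \<noteq> 0\<close> by (simp flip: embed_mult)
        then have "e ?d * (e a * e c) = e c" by (metis mult.assoc mult_1)
        then show ?thesis by (simp add: algebra_simps)
      qed
      then show ?thesis
        using add_left_mono[OF 2(3)[of "b + a * c"], of "v (e ?d)"] d a
        by (simp add: val_mult add.commute)
    qed
    moreover have "v ?t = 0" using d a by (simp add: val_mult add.commute)
    ultimately have "residue_transcendental e v ?t"
      by (intro residue_transcendental_if_residue_outside)
    then show ?thesis
      unfolding almost_pure_extension_def pure_extension_def valuation_transcendental_def by blast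
  next
    case 3
    then interpret no_best_approximation v0 w v e x by unfold_locales
    show ?thesis
      using immediate transcendental_immediate
      by (auto simp: almost_pure_extension_def pure_extension_def algebraic_completion_type_def
          appr_algebraic_immediate_def)
  qed
qed

end

lemma transcendental_not_in_range:
  fixes e :: "'k :: field \<Rightarrow> 'l :: field"
  assumes "simple_transcendental_extension e x"
  shows "x \<notin> range e"
proof
  let ?L = "ring_of_type_algebra :: 'l ring"
  interpret L: field ?L by (rule field_from_type_algebra)
  have e: "field_embedding e" and x: "L.transcendental (range e) x"
    using assms by (auto simp: simple_transcendental_extension_def)
  assume "x \<in> range e"
  then obtain a where a: "x = e a" by blast
  have one: "e 1 = 1" and add: "e (a + b) = e a + e b" for a b
    using e by (auto simp: field_embedding_def ring_hom_def ring_of_type_algebra_def)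
  have "e 0 = 0" by (rule add_left_imp_eq[of "e 0"]) (simp flip: add)
  then have "- x = e (- a)" using add[of a "- a"] a by (simp add: neg_eq_iff_add_eq_0)
  \<comment> \<open>The polynomial \<open>X - x\<close> would have coefficients in the image of \<open>e\<close> and the root \<open>x\<close>.\<close>
  then have mem: "[1, - x] \<in> carrier ((range e)[X]\<^bsub>?L\<^esub>)"
    using one by (auto simp: univ_poly_def polynomial_def ring_of_type_algebra_def
        intro: range_eqI[OF sym])
  have "L.eval [1, - x] x = \<zero>\<^bsub>?L\<^esub>"
  proof -
    have L: "carrier ?L = UNIV" "\<And>a b. a \<otimes>\<^bsub>?L\<^esub> b = a * b" "\<And>a b. a \<oplus>\<^bsub>?L\<^esub> b = a + b"
      "\<one>\<^bsub>?L\<^esub> = 1" "\<zero>\<^bsub>?L\<^esub> = 0"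
      by (simp_all add: ring_of_type_algebra_def)
    have "x [^]\<^bsub>?L\<^esub> (0::nat) = 1" "x [^]\<^bsub>?L\<^esub> (1::nat) = x"
      using L.nat_pow_0[of x] L.nat_pow_eone[of x] by (simp_all add: L)
    then show ?thesis by (simp add: L)
  qed
  with mem have "[1, - x] = []"
    using x by (intro L.eval_transcendental[of "range e" x]) (simp_all add: over_def)
  then show False by simp
qed

theorem proposition5p6:
  fixes v0 :: "'k :: field \<Rightarrow> 'g :: linordered_ab_group_add extended"
    and e :: "'k \<Rightarrow> 'l :: field"
    and x :: 'l
  assumes "krull_valuation v0"
    and "simple_transcendental_extension e x"
    and "\<exists>w :: 'k alg_closure \<Rightarrow> 'h :: linordered_ab_group_add extended.
           krull_valuation w \<and> extends_valuation to_ac v0 w \<and> dense_in_extension to_ac w"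
  shows "divisible (value_group v0) \<and>
         algebraically_closed (residue_field v0) \<and>
         (\<forall>v :: 'l \<Rightarrow> 'i :: linordered_ab_group_add extended.
            krull_valuation v \<and> extends_valuation e v0 v \<longrightarrow> almost_pure_extension e v x)"
proof -
  obtain w :: "'k alg_closure \<Rightarrow> 'h extended"
    where w: "krull_valuation w" "extends_valuation to_ac v0 w" "dense_in_extension to_ac w"
    using assms(3) by blast
  have "field_embedding (to_ac :: 'k \<Rightarrow> 'k alg_closure)"
    by (auto simp: field_embedding_def ring_hom_def ring_of_type_algebra_def)
  then interpret ac: dense_in_closure v0 w
    using assms(1) w
    by (intro dense_in_closure.intro valued_extension.intro valued_extension_axioms.intro
        dense_in_closure_axioms.intro)
  have "almost_pure_extension e v x" if "krull_valuation v" "extends_valuation e v0 v"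
    for v :: "'l \<Rightarrow> 'i extended"
  proof -
    have "valued_extension v0 v e"
      using assms(1,2) that
      by (auto simp: valued_extension_def valued_extension_axioms_def
          simple_transcendental_extension_def)
    then interpret dense_extension v0 w v e
      by (intro dense_extension.intro ac.dense_in_closure_axioms)
    show ?thesis by (rule almost_pure[OF transcendental_not_in_range[OF assms(2)]])
  qed
  then show ?thesis
    using ac.divisible_value_group ac.algebraically_closed_residue_field by blast
qed

end
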